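(* Let $G$ be a graph that has an induced $k$-partite representation in the hypercube. Then the maximum number of edges of a subgraph of $Q_n$ containing no induced copy of $G$ is $o(|E(Q_n)|)$ as $n\to\infty$.
   Context: Identify the vertices of the hypercube $Q_n$ with subsets of $[n]$, two being adjacent iff their symmetric difference has size $1$; the $k$-th vertex layer is $\binom{[n]}{k}$. A down $k$-star is the star consisting of a vertex $X$ of the $k$-th vertex layer together with its $k$ edges to the $(k-1)$-th vertex layer. For a set $A$ of vertices in the $k$-th vertex layer of $Q_n$, $\mathcal H_A$ is the $k$-uniform hypergraph on $[n]$ whose edges are the sets in $A$. A graph $G$ has a (partite) representation if there are integers $k,n$ and a set $A$ of vertices of the $k$-th vertex layer of $Q_n$ such that $\mathcal H_A$ is $k$-partite (its vertex set splits into $k$ parts, each edge meeting every part in exactly one vertex) and $G$ is isomorphic to a subgraph $G'$ of the union of the down $k$-stars centered at the vertices of $A$; the representation is induced if $G'$ is an induced subgraph of $Q_n$. *)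

theory Defs
  imports Complex_Main "HOL-Library.Landau_Symbols" "HOL-Library.Disjoint_Sets"
begin

text \<open>A graph (or hypergraph) is a pair of a vertex set and a set of edges; the edges are
  themselves sets of vertices.\<close>

type_synonym 'a ugraph = "'a set \<times> 'a set set"

abbreviation verts :: "'a ugraph \<Rightarrow> 'a set" where "verts \<equiv> fst"
abbreviation edges :: "'a ugraph \<Rightarrow> 'a set set" where "edges \<equiv> snd"

definition simple_graph :: "'a ugraph \<Rightarrow> bool" where
  "simple_graph G \<longleftrightarrow> finite (verts G) \<and> (\<forall>e \<in> edges G. e \<subseteq> verts G \<and> card e = 2)"

definition subgraph :: "'a ugraph \<Rightarrow> 'a ugraph \<Rightarrow> bool" where
  "subgraph H G \<longleftrightarrow> simple_graph H \<and> verts H \<subseteq> verts G \<and> edges H \<subseteq> edges G"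

definition induced_subgraph :: "'a ugraph \<Rightarrow> 'a ugraph \<Rightarrow> bool" where
  "induced_subgraph H G \<longleftrightarrow> subgraph H G \<and> edges H = {e \<in> edges G. e \<subseteq> verts H}"

definition isomorphic :: "'a ugraph \<Rightarrow> 'b ugraph \<Rightarrow> bool" where
  "isomorphic G H \<longleftrightarrow>
     (\<exists>f. bij_betw f (verts G) (verts H) \<and> edges H = (\<lambda>e. f ` e) ` edges G)"

definition hypercube :: "nat \<Rightarrow> nat set ugraph" where
  "hypercube n =
     (Pow {1..n}, {{X, Y} | X Y. X \<subseteq> {1..n} \<and> Y \<subseteq> {1..n} \<and> card (sym_diff X Y) = 1})"

definition vertex_layer :: "nat \<Rightarrow> nat \<Rightarrow> nat set set" where
  "vertex_layer n k = {X \<in> verts (hypercube n). card X = k}"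

text \<open>For \<open>k = 0\<close> the truncated \<open>k - 1\<close> is harmless: no two vertices of layer 0 are adjacent,
  so the star is the single vertex \<open>X\<close>.\<close>

definition down_nbrs :: "nat \<Rightarrow> nat \<Rightarrow> nat set \<Rightarrow> nat set set" where
  "down_nbrs n k X = {Y \<in> vertex_layer n (k - 1). {X, Y} \<in> edges (hypercube n)}"

definition down_star :: "nat \<Rightarrow> nat \<Rightarrow> nat set \<Rightarrow> nat set ugraph" where
  "down_star n k X = (insert X (down_nbrs n k X), {{X, Y} | Y. Y \<in> down_nbrs n k X})"

definition down_stars_union :: "nat \<Rightarrow> nat \<Rightarrow> nat set set \<Rightarrow> nat set ugraph" where
  "down_stars_union n k A =
     (\<Union>X\<in>A. verts (down_star n k X), \<Union>X\<in>A. edges (down_star n k X))"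

definition layer_hypergraph :: "nat \<Rightarrow> nat set set \<Rightarrow> nat ugraph" where
  "layer_hypergraph n A = ({1..n}, A)"

definition k_partite :: "nat \<Rightarrow> 'a ugraph \<Rightarrow> bool" where
  "k_partite k H \<longleftrightarrow>
     (\<exists>P :: nat \<Rightarrow> 'a set. disjoint_family_on P {..<k} \<and> (\<Union>i<k. P i) = verts H \<and>
        (\<forall>e \<in> edges H. \<forall>i<k. card (e \<inter> P i) = 1))"

definition has_induced_partite_representation :: "nat \<Rightarrow> 'a ugraph \<Rightarrow> bool" where
  "has_induced_partite_representation k G \<longleftrightarrow>
     (\<exists>n A G'. A \<subseteq> vertex_layer n k \<and> k_partite k (layer_hypergraph n A) \<and>
        subgraph G' (down_stars_union n k A) \<and> induced_subgraph G' (hypercube n) \<and>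
        isomorphic G G')"

definition contains_induced_copy :: "'b ugraph \<Rightarrow> 'a ugraph \<Rightarrow> bool" where
  "contains_induced_copy H G \<longleftrightarrow> (\<exists>G'. induced_subgraph G' H \<and> isomorphic G G')"

definition contains_copy_induced_in :: "'b ugraph \<Rightarrow> 'b ugraph \<Rightarrow> 'a ugraph \<Rightarrow> bool" where
  "contains_copy_induced_in Q H G \<longleftrightarrow>
     (\<exists>G'. subgraph G' H \<and> induced_subgraph G' Q \<and> isomorphic G G')"

text \<open>Both extremal numbers are suprema of finite sets of naturals, hence maxima; only for the
  graph without vertices, which every graph contains, is the set empty and the value 0.
  In \<open>ex_induced\<close> a copy of \<open>G\<close> must be induced in the host subgraph \<open>H\<close>; in
  \<open>ex_cube_induced\<close> it must lie in \<open>H\<close> and be induced in the whole cube. The latter kind of copy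
  is in particular induced in \<open>H\<close>, so \<open>ex_induced n G \<le> ex_cube_induced n G\<close>.\<close>

definition ex_induced :: "nat \<Rightarrow> 'a ugraph \<Rightarrow> nat" where
  "ex_induced n G =
     Sup {card (edges H) | H. subgraph H (hypercube n) \<and> \<not> contains_induced_copy H G}"

definition ex_cube_induced :: "nat \<Rightarrow> 'a ugraph \<Rightarrow> nat" where
  "ex_cube_induced n G =
     Sup {card (edges H) | H. subgraph H (hypercube n) \<and>
            \<not> contains_copy_induced_in (hypercube n) H G}"

end

theory Submission
  imports Defs
begin

text \<open>Let \<open>H\<close> be a subgraph of \<open>Q\<^sub>n\<close> of positive density. By convexity, vertices \<open>X\<close> have on average
  a positive proportion of \<open>k\<close>-tuples in \<open>X\<close> all of whose entries \<open>x\<close> give an edge \<open>{X, X - {x}}\<close>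
  of \<open>H\<close>. Averaging over the base \<open>S\<close> that remains when the tuple is removed from \<open>X\<close>, some \<open>S\<close>
  carries a dense \<open>k\<close>-uniform hypergraph of sets \<open>K\<close> such that the whole down \<open>k\<close>-star of
  \<open>S \<union> K\<close> in the directions \<open>K\<close> lies in \<open>H\<close>. By the theorem of Erdos this hypergraph contains
  a large complete \<open>k\<close>-partite hypergraph, hence a copy \<open>\<phi>\<close> of the representing one.
  The map \<open>X \<mapsto> S \<union> \<phi> X\<close> embeds the small cube as a subcube, so it preserves inducedness.\<close>

section \<open>Convexity of powers and counts of tuples\<close>

text \<open>Jensen for \<open>y ^ k\<close> by way of the tangent at \<open>a\<close>. Bernoulli's
  inequality for \<open>y / a - 1 \<ge> -1\<close> puts the tangent below \<open>y ^ k\<close> for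
  all \<open>y \<ge> 0\<close>; its slope is nonnegative, so an average above \<open>a\<close> only
  raises the summed tangents.\<close>

lemma sum_power_ge_of_average:
  fixes f :: "'a \<Rightarrow> real" and a :: real
  assumes "finite A" and nonneg: "\<And>x. x \<in> A \<Longrightarrow> 0 \<le> f x" and "0 \<le> a"
    and avg: "a * card A \<le> (\<Sum>x\<in>A. f x)"
  shows "card A * a ^ k \<le> (\<Sum>x\<in>A. f x ^ k)"
proof (cases "a = 0")
  case True
  then show ?thesis
    using nonneg by (cases k) (auto intro: sum_nonneg)
next
  case False
  then have a: "a > 0" using assms by simp
  have tangent: "a ^ k * (1 + k * (f x / a - 1)) \<le> f x ^ k" if "x \<in> A" for x
  proof -
    have "1 + real k * (f x / a - 1) \<le> (1 + (f x / a - 1)) ^ k"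
      using nonneg[OF that] a by (intro Bernoulli_inequality) simp
    then have "a ^ k * (1 + k * (f x / a - 1)) \<le> a ^ k * (f x / a) ^ k"
      using a by (intro mult_left_mono) auto
    also have "\<dots> = f x ^ k" using a by (simp add: power_divide)
    finally show ?thesis .
  qed
  have "real (card A) \<le> (\<Sum>x\<in>A. f x) / a"
    using avg a by (simp add: field_simps)
  then have "0 \<le> real k * ((\<Sum>x\<in>A. f x) / a - card A)" by simp
  then have "0 \<le> a ^ k * (real k * ((\<Sum>x\<in>A. f x) / a - card A))" using a by simp
  then have "card A * a ^ k \<le> a ^ k * (card A + k * ((\<Sum>x\<in>A. f x) / a - card A))"
    by (simp only: distrib_left mult.commute[of _ "a ^ k"])
  also have "\<dots> = (\<Sum>x\<in>A. a ^ k * (1 + k * (f x / a - 1)))"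
    by (simp add: sum.distrib sum_subtractf flip: sum_distrib_left sum_divide_distrib)
  also have "\<dots> \<le> (\<Sum>x\<in>A. f x ^ k)" by (rule sum_mono) (rule tangent)
  finally show ?thesis .
qed

text \<open>Lists with repetitions stand in for \<open>k\<close>-sets: their number is an exact
  power, so densities multiply, and an induction on \<open>k\<close> can split off the head.\<close>

definition tuples :: "nat \<Rightarrow> 'a set \<Rightarrow> 'a list set" where
  "tuples k V = {xs. set xs \<subseteq> V \<and> length xs = k}"

lemma finite_tuples: "finite V \<Longrightarrow> finite (tuples k V)"
  by (simp add: tuples_def finite_lists_length_eq)

lemma card_tuples: "finite V \<Longrightarrow> card (tuples k V) = card V ^ k"
  by (simp add: tuples_def card_lists_length_eq)

text \<open>Each of the \<open>t\<close> factors of the falling factorial is at least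
  \<open>card V - (s + t)\<close>, and Bernoulli makes the bound linear. Thus repetitions and hits
  of \<open>W\<close> cost only a fraction of order \<open>1 / card V\<close>.\<close>

lemma card_distinct_tuples_ge:
  assumes "finite V" "finite W" "card W \<le> s" "s + t \<le> card V" "V \<noteq> {}"
  shows "real (card V) ^ t * (1 - t * (s + t) / card V)
           \<le> card {xs \<in> tuples t (V - W). distinct xs}"
proof -
  define n where "n = card V"
  have n: "n > 0" using assms by (simp add: n_def card_gt_0_iff)
  have cVW: "n - s \<le> card (V - W)"
    using diff_card_le_card_Diff[of W V] assms by (simp add: n_def)
  have "real n ^ t * (1 - t * (s + t) / n) \<le> real n ^ t * (1 - (s + t) / n) ^ t"
  proof (rule mult_left_mono)
    have "1 + real t * (- ((s + t) / n)) \<le> (1 + (- ((s + t) / n))) ^ t"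
      using assms n by (intro Bernoulli_inequality) (simp add: n_def field_simps)
    then show "1 - real (t * (s + t)) / n \<le> (1 - real (s + t) / n) ^ t" by simp
  qed simp
  also have "\<dots> = (real n - (s + t)) ^ t"
    using n by (simp add: field_simps flip: power_mult_distrib)
  also have "\<dots> = real ((n - (s + t)) ^ t)"
    using assms by (simp add: n_def of_nat_diff)
  also have "(n - (s + t)) ^ t \<le> \<Prod>{card (V - W) - t + 1..card (V - W)}"
  proof -
    have "(n - (s + t)) ^ t = (\<Prod>i\<in>{card (V - W) - t + 1..card (V - W)}. n - (s + t))"
      using cVW assms by (simp add: n_def)
    also have "\<dots> \<le> \<Prod>{card (V - W) - t + 1..card (V - W)}"
      using cVW by (intro prod_mono) auto
    finally show ?thesis .
  qed
  also have "\<Prod>{card (V - W) - t + 1..card (V - W)} =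
      card {xs. length xs = t \<and> distinct xs \<and> set xs \<subseteq> V - W}"
    using assms cVW by (intro card_lists_distinct_length_eq[symmetric]) (auto simp: n_def)
  also have "{xs. length xs = t \<and> distinct xs \<and> set xs \<subseteq> V - W} =
      {xs \<in> tuples t (V - W). distinct xs}"
    by (auto simp: tuples_def)
  finally show ?thesis by (simp add: n_def)
qed

section \<open>The theorem of Erdos for ordered tuples\<close>

text \<open>Double counting of the pairs \<open>vs\<close>, \<open>xs\<close> with
  \<open>v # xs \<in> E\<close> for every entry \<open>v\<close> of \<open>vs\<close>. A tail
  \<open>xs\<close> with \<open>d\<close> possible heads lies in exactly \<open>d ^ t\<close> pairs,
  since \<open>vs\<close> may repeat entries; \<open>d\<close> is on average at least
  \<open>\<delta> * card V\<close>, and convexity bounds the sum of the powers.\<close>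

lemma sum_card_common_links_ge:
  assumes "finite V" "E \<subseteq> tuples (Suc k) V" "0 \<le> \<delta>" "\<delta> * real (card V) ^ Suc k \<le> card E"
  shows "\<delta> ^ t * real (card V) ^ t * real (card V) ^ k
           \<le> (\<Sum>vs\<in>tuples t V. real (card {xs \<in> tuples k V. \<forall>v\<in>set vs. v # xs \<in> E}))"
proof -
  define D where "D xs = {v \<in> V. v # xs \<in> E}" for xs
  have "E = (\<lambda>(xs, v). v # xs) ` (SIGMA xs:tuples k V. D xs)"
  proof (intro equalityI subsetI)
    fix ys assume ys: "ys \<in> E"
    then obtain v xs where "ys = v # xs"
      using assms(2) by (cases ys) (auto simp: tuples_def)
    then show "ys \<in> (\<lambda>(xs, v). v # xs) ` (SIGMA xs:tuples k V. D xs)"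
      using ys assms(2) by (force simp: D_def tuples_def)
  qed (auto simp: D_def)
  moreover have "inj_on (\<lambda>(xs, v). v # xs) (SIGMA xs:tuples k V. D xs)"
    by (auto simp: inj_on_def)
  ultimately have "card E = card (SIGMA xs:tuples k V. D xs)" by (metis card_image)
  also have "\<dots> = (\<Sum>xs\<in>tuples k V. card (D xs))"
    using assms(1) by (intro card_SigmaI) (auto simp: D_def finite_tuples)
  finally have "\<delta> * card V * card (tuples k V) \<le> (\<Sum>xs\<in>tuples k V. real (card (D xs)))"
    using assms by (simp add: card_tuples algebra_simps)
  then have "card (tuples k V) * (\<delta> * card V) ^ t \<le> (\<Sum>xs\<in>tuples k V. real (card (D xs)) ^ t)"
    using assms by (intro sum_power_ge_of_average) (auto simp: finite_tuples)
  also have "\<dots> = real (\<Sum>xs\<in>tuples k V. card {vs \<in> tuples t V. \<forall>v\<in>set vs. v # xs \<in> E})"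
  proof -
    have "card (D xs) ^ t = card {vs \<in> tuples t V. \<forall>v\<in>set vs. v # xs \<in> E}" for xs
    proof -
      have "{vs \<in> tuples t V. \<forall>v\<in>set vs. v # xs \<in> E} = tuples t (D xs)"
        by (auto simp: tuples_def D_def)
      then show ?thesis using assms(1) by (simp add: card_tuples D_def)
    qed
    then show ?thesis by (simp flip: of_nat_power)
  qed
  also have "(\<Sum>xs\<in>tuples k V. card {vs \<in> tuples t V. \<forall>v\<in>set vs. v # xs \<in> E}) =
      (\<Sum>vs\<in>tuples t V. card {xs \<in> tuples k V. \<forall>v\<in>set vs. v # xs \<in> E})"
    using assms(1) by (intro sum_multicount_gen) (auto simp: finite_tuples)
  finally show ?thesis
    using assms(1) by (simp add: card_tuples power_mult_distrib mult_ac)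
qed

text \<open>The theorem of Erdos on dense \<open>k\<close>-partite hypergraphs, for ordered tuples. The set \<open>W\<close>
  of forbidden vertices makes the induction produce disjoint blocks.\<close>

lemma dense_tuples_contain_blocks:
  fixes \<delta> :: real
  assumes "\<delta> > 0"
  shows "\<exists>N. \<forall>(V :: 'a set) W E. finite V \<and> N \<le> card V \<and> finite W \<and> card W \<le> s \<and>
      E \<subseteq> tuples k V \<and> \<delta> * real (card V) ^ k \<le> card E \<longrightarrow>
      (\<exists>B. (\<forall>i<k. B i \<subseteq> V - W \<and> card (B i) = t) \<and> disjoint_family_on B {..<k} \<and>
        (\<forall>xs. length xs = k \<and> (\<forall>i<k. xs ! i \<in> B i) \<longrightarrow> xs \<in> E))"
  using assms
proof (induction k arbitrary: \<delta> s)
  case 0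
  have "[] \<in> E" if "E \<subseteq> tuples 0 V" "\<delta> * real (card V) ^ 0 \<le> card E"
    for V :: "'a set" and E
  proof -
    have "card E \<noteq> 0" using that 0 by (metis mult.right_neutral not_le of_nat_0 power_0)
    then obtain xs where "xs \<in> E" by fastforce
    then show ?thesis using that by (auto simp: tuples_def)
  qed
  then show ?case by (intro exI[of _ 0]) (auto simp: disjoint_family_on_def)
next
  case (Suc k)
  \<comment> \<open>Common links of \<open>t\<close>-tuples have average density at least
    \<open>\<delta> ^ t\<close>; half of it is given up for the tuples that cannot serve as a block.
    The forbidden set grows by the \<open>t\<close> vertices of the new block, hence
    \<open>s + t\<close>.\<close>
  have "\<delta> ^ t / 2 > 0" using Suc.prems by simp
  from Suc.IH[OF this, of "s + t"] obtain N1 where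
    N1: "\<forall>(V :: 'a set) W E. finite V \<and> N1 \<le> card V \<and> finite W \<and> card W \<le> s + t \<and>
      E \<subseteq> tuples k V \<and> \<delta> ^ t / 2 * real (card V) ^ k \<le> card E \<longrightarrow>
      (\<exists>B. (\<forall>i<k. B i \<subseteq> V - W \<and> card (B i) = t) \<and> disjoint_family_on B {..<k} \<and>
        (\<forall>xs. length xs = k \<and> (\<forall>i<k. xs ! i \<in> B i) \<longrightarrow> xs \<in> E))"
    by (rule exE)
  \<comment> \<open>For \<open>card V > r\<close>, the bound \<open>t * (s + t) / card V\<close> on
    the fraction of \<open>t\<close>-tuples that repeat an entry or meet \<open>W\<close> is below
    \<open>\<delta> ^ t / 2\<close>.\<close>
  define r where "r = 2 * real (t * (s + t)) / \<delta> ^ t"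
  define N where "N = N1 + (s + t) + nat \<lceil>r\<rceil> + 1"
  show ?case
  proof (intro exI[of _ N] allI impI, elim conjE)
    fix V W :: "'a set" and E
    assume V: "finite V" and NV: "N \<le> card V" and W: "finite W" "card W \<le> s"
      and E: "E \<subseteq> tuples (Suc k) V" and dens: "\<delta> * real (card V) ^ Suc k \<le> card E"
    define n where "n = card V"
    have n: "n > 0" "s + t \<le> n" "N1 \<le> n" using NV by (auto simp: N_def n_def)
    have "r < n" using NV by (simp add: N_def n_def) linarith
    then have small: "real (t * (s + t)) / n < \<delta> ^ t / 2"
      using Suc.prems n by (simp add: r_def field_simps)
    define F where "F vs = {xs \<in> tuples k V. \<forall>v\<in>set vs. v # xs \<in> E}" for vs
    define good where "good = {vs \<in> tuples t (V - W). distinct vs}"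
    have good_sub: "good \<subseteq> tuples t V" by (auto simp: good_def tuples_def)
    have fin: "finite (tuples t V)" "finite good"
      using V good_sub by (auto simp: finite_tuples intro: finite_subset)
    have F_le: "real (card (F vs)) \<le> real n ^ k" for vs
    proof -
      have "card (F vs) \<le> card (tuples k V)"
        using V by (intro card_mono) (auto simp: F_def finite_tuples)
      then show ?thesis using V
        by (simp add: card_tuples n_def flip: of_nat_power)
    qed
    have good_ge: "real n ^ t * (1 - t * (s + t) / n) \<le> card good"
    proof -
      have "V \<noteq> {}" using n by (auto simp: n_def)
      then show ?thesis
        using card_distinct_tuples_ge[of V W s t] V W n by (simp add: n_def good_def)
    qed
    \<comment> \<open>Otherwise the tuples outside \<open>good\<close> contribute less than
      \<open>\<delta> ^ t / 2\<close> of the maximum \<open>n ^ t * n ^ k\<close> because they are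
      few, and the good ones at most \<open>\<delta> ^ t / 2\<close> because their links are sparse:
      together less than the average requires.\<close>
    have "\<exists>vs\<in>good. \<delta> ^ t / 2 * real n ^ k \<le> card (F vs)"
    proof (rule ccontr)
      assume "\<not> ?thesis"
      then have lt: "real (card (F vs)) \<le> \<delta> ^ t / 2 * real n ^ k" if "vs \<in> good" for vs
        using that by force
      have "\<delta> ^ t * real n ^ t * real n ^ k \<le> (\<Sum>vs\<in>tuples t V. real (card (F vs)))"
        using sum_card_common_links_ge[OF V E _ dens] Suc.prems by (simp add: F_def n_def)
      also have "\<dots> = (\<Sum>vs\<in>tuples t V - good. real (card (F vs))) + (\<Sum>vs\<in>good. real (card (F vs)))"
        using fin good_sub by (intro sum.subset_diff) auto
      also have "\<dots> \<le> (\<Sum>vs\<in>tuples t V - good. real n ^ k) + (\<Sum>vs\<in>good. \<delta> ^ t / 2 * real n ^ k)"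
        by (intro add_mono sum_mono F_le lt) auto
      also have "\<dots> = (real n ^ t - card good) * real n ^ k + card good * (\<delta> ^ t / 2 * real n ^ k)"
        using fin good_sub V
        by (simp add: card_Diff_subset of_nat_diff card_mono card_tuples n_def
            flip: of_nat_power card_tuples)
      also have "\<dots> \<le> (t * (s + t) / n * real n ^ t) * real n ^ k +
          real n ^ t * (\<delta> ^ t / 2 * real n ^ k)"
      proof (intro add_mono mult_right_mono)
        show "real n ^ t - card good \<le> t * (s + t) / n * real n ^ t"
          using good_ge by (simp add: algebra_simps)
        show "real (card good) \<le> real n ^ t"
          using card_mono[OF fin(1) good_sub] V by (simp add: card_tuples n_def flip: of_nat_power)
      qed (use Suc.prems in auto)
      also have "\<dots> = (t * (s + t) / n + \<delta> ^ t / 2) * (real n ^ t * real n ^ k)"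
        by (simp add: algebra_simps)
      also have "\<dots> < (\<delta> ^ t / 2 + \<delta> ^ t / 2) * (real n ^ t * real n ^ k)"
        using n by (intro mult_strict_right_mono add_strict_right_mono small) auto
      finally show False by simp
    qed
    then obtain vs where vs: "vs \<in> good" and Fvs: "\<delta> ^ t / 2 * real n ^ k \<le> card (F vs)"
      by blast
    have card_vs: "card (set vs) = t" and vs_sub: "set vs \<subseteq> V - W"
      using vs by (auto simp: good_def tuples_def distinct_card)
    have "card (W \<union> set vs) \<le> s + t"
      using card_Un_le[of W "set vs"] W card_vs by simp
    then have "\<exists>B. (\<forall>i<k. B i \<subseteq> V - (W \<union> set vs) \<and> card (B i) = t) \<and>
        disjoint_family_on B {..<k} \<and>
        (\<forall>xs. length xs = k \<and> (\<forall>i<k. xs ! i \<in> B i) \<longrightarrow> xs \<in> F vs)"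
      using V W n Fvs by (intro N1[rule_format]) (auto simp: n_def F_def)
    then obtain B where B: "\<And>i. i < k \<Longrightarrow> B i \<subseteq> V - (W \<union> set vs) \<and> card (B i) = t"
      and disj: "disjoint_family_on B {..<k}"
      and BF: "\<And>xs. length xs = k \<Longrightarrow> (\<And>i. i < k \<Longrightarrow> xs ! i \<in> B i) \<Longrightarrow> xs \<in> F vs"
      by meson
    \<comment> \<open>The heads form block 0 and the blocks of the common link move up by one
      index.\<close>
    define B' where "B' = case_nat (set vs) B"
    have "B' i \<subseteq> V - W \<and> card (B' i) = t" if "i < Suc k" for i
      using that B card_vs vs_sub by (cases i) (force simp: B'_def)+
    moreover have "disjoint_family_on B' {..<Suc k}"
      unfolding disjoint_family_on_def
    proof (intro ballI impI)
      fix i j assume "i \<in> {..<Suc k}" "j \<in> {..<Suc k}" "i \<noteq> j"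
      then show "B' i \<inter> B' j = {}"
        using B disj by (cases i; cases j) (force simp: B'_def disjoint_family_on_def)+
    qed
    moreover have "ys \<in> E" if ys: "length ys = Suc k" "\<forall>i<Suc k. ys ! i \<in> B' i" for ys
    proof -
      obtain v xs where ys_eq: "ys = v # xs" using ys by (cases ys) auto
      have "v \<in> set vs" using ys(2)[rule_format, of 0] by (simp add: ys_eq B'_def)
      moreover have "xs \<in> F vs"
      proof (rule BF)
        show "xs ! i \<in> B i" if "i < k" for i
          using ys(2)[rule_format, of "Suc i"] that by (simp add: ys_eq B'_def)
      qed (use ys ys_eq in simp)
      ultimately show ?thesis by (simp add: F_def ys_eq)
    qed
    ultimately show "\<exists>B. (\<forall>i<Suc k. B i \<subseteq> V - W \<and> card (B i) = t) \<and>
        disjoint_family_on B {..<Suc k} \<and>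
        (\<forall>xs. length xs = Suc k \<and> (\<forall>i<Suc k. xs ! i \<in> B i) \<longrightarrow> xs \<in> E)"
      by blast
  qed
qed

section \<open>Edges of the cube, down-directions and a dense base\<close>

definition down_directions :: "nat set ugraph \<Rightarrow> nat set \<Rightarrow> nat set" where
  "down_directions H X = {x \<in> X. {X, X - {x}} \<in> edges H}"

lemma hypercube_edgeE:
  assumes "e \<in> edges (hypercube n)"
  obtains X x where "X \<subseteq> {1..n}" "x \<in> X" "e = {X, X - {x}}"
proof -
  obtain X Y where XY: "X \<subseteq> {1..n}" "Y \<subseteq> {1..n}" "card (sym_diff X Y) = 1" "e = {X, Y}"
    using assms by (auto simp: hypercube_def)
  then obtain z where z: "sym_diff X Y = {z}" by (auto simp: card_1_singleton_iff)
  show thesis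
  proof (cases "z \<in> X")
    case True
    then have "Y = X - {z}" using z by auto
    then show thesis using True XY that by blast
  next
    case False
    moreover have "z \<in> sym_diff X Y" using z by simp
    ultimately have "z \<in> Y" by simp
    moreover have "sym_diff Y X = {z}" using z by (simp add: Un_commute)
    ultimately have "z \<in> Y" "X = Y - {z}" by auto
    then show thesis using XY that[of Y z] by (simp add: insert_commute)
  qed
qed

lemma hypercube_edgeI:
  assumes "X \<subseteq> {1..n}" "x \<in> X"
  shows "{X, X - {x}} \<in> edges (hypercube n)"
proof -
  have "sym_diff X (X - {x}) = {x}" using assms by auto
  then have "card (sym_diff X (X - {x})) = 1" by simp
  then show ?thesis using assms unfolding hypercube_def by auto
qed

text \<open>Every cube edge is counted once, at its larger end.\<close>

lemma card_edges_eq_sum_down_directions: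
  assumes "edges H \<subseteq> edges (hypercube n)"
  shows "card (edges H) = (\<Sum>X\<in>Pow {1..n}. card (down_directions H X))"
proof -
  let ?P = "SIGMA X:Pow {1..n}. down_directions H X"
  let ?e = "\<lambda>(X, x). {X, X - {x}}"
  have "inj_on ?e ?P"
  proof (rule inj_onI, clarify)
    fix X x Y y
    assume x: "x \<in> down_directions H X" and y: "y \<in> down_directions H Y"
      and eq: "{X, X - {x}} = {Y, Y - {y}}"
    \<comment> \<open>Union and intersection of the two ends recover the larger and the smaller one
      from the unordered edge.\<close>
    have "\<Union>{X, X - {x}} = \<Union>{Y, Y - {y}}" "\<Inter>{X, X - {x}} = \<Inter>{Y, Y - {y}}"
      using eq by simp_all
    then have "X = Y" "X - {x} = Y - {y}" by auto
    then show "X = Y \<and> x = y" using x y by (auto simp: down_directions_def)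
  qed
  moreover have "edges H = ?e ` ?P"
  proof (intro equalityI subsetI)
    fix e assume e: "e \<in> edges H"
    then have "e \<in> edges (hypercube n)" using assms by blast
    then obtain X x where X: "X \<subseteq> {1..n}" "x \<in> X" "e = {X, X - {x}}" by (rule hypercube_edgeE)
    then have "(X, x) \<in> ?P" using e by (simp add: down_directions_def)
    then show "e \<in> ?e ` ?P" using X by (intro image_eqI[of _ _ "(X, x)"]) simp_all
  qed (auto simp: down_directions_def)
  ultimately have "card (edges H) = card ?P" by (simp only: card_image)
  also have "\<dots> = (\<Sum>X\<in>Pow {1..n}. card (down_directions H X))"
    by (intro card_SigmaI) (auto simp: down_directions_def intro: finite_subset)
  finally show ?thesis .
qed

text \<open>Every vertex has all its elements as down-directions, and the sizes of a set and its
  complement add up to \<open>n\<close>.\<close>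

lemma card_edges_hypercube: "2 * card (edges (hypercube n)) = n * 2 ^ n"
proof -
  have eq: "card (edges (hypercube n)) = (\<Sum>X\<in>Pow {1..n}. card X)"
  proof -
    have "down_directions (hypercube n) X = X" if "X \<subseteq> {1..n}" for X
      using that hypercube_edgeI by (auto simp: down_directions_def)
    then show ?thesis
      unfolding card_edges_eq_sum_down_directions[OF subset_refl] by (intro sum.cong) auto
  qed
  have "(\<Sum>X\<in>Pow {1..n}. card X) = (\<Sum>X\<in>Pow {1..n}. card ({1..n} - X))"
    by (rule sum.reindex_bij_witness[where i="\<lambda>X. {1..n} - X" and j="\<lambda>X. {1..n} - X"])
      (auto simp: double_diff)
  then have "2 * card (edges (hypercube n)) = (\<Sum>X\<in>Pow {1..n}. card X + card ({1..n} - X))"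
    by (simp add: eq sum.distrib)
  also have "\<dots> = (\<Sum>X\<in>Pow {1..n}. n)"
  proof (rule sum.cong)
    fix X assume "X \<in> Pow {1..n}"
    then have "finite X" "X \<subseteq> {1..n}" by (auto intro: finite_subset)
    then show "card X + card ({1..n} - X) = n"
      using card_mono[of "{1..n}" X] by (simp add: card_Diff_subset)
  qed simp
  finally show ?thesis by (simp add: card_Pow)
qed

text \<open>Sending a vertex \<open>X\<close> with a tuple \<open>xs\<close> of down-directions to \<open>(X - set xs, xs)\<close> is
  injective, so some base \<open>S\<close> receives at least the average number of tuples. No restriction to
  the middle layers is needed, and the tuples may have repetitions.\<close>

lemma dense_subgraph_has_dense_base:
  fixes \<epsilon> :: real
  assumes H: "edges H \<subseteq> edges (hypercube n)" and "0 \<le> \<epsilon>"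
    and dens: "\<epsilon> * n * 2 ^ n \<le> card (edges H)"
  obtains S where "S \<subseteq> {1..n}"
    "\<epsilon> ^ k * real n ^ k \<le> card {xs \<in> tuples k ({1..n} - S).
        set xs \<subseteq> down_directions H (S \<union> set xs)}"
proof -
  define E where "E S = {xs \<in> tuples k ({1..n} - S). set xs \<subseteq> down_directions H (S \<union> set xs)}" for S
  let ?T = "SIGMA X:Pow {1..n}. tuples k (down_directions H X)"
  have fin_dd: "finite (down_directions H X)" if "X \<subseteq> {1..n}" for X
    using that by (auto simp: down_directions_def intro: finite_subset)
  have finE: "finite (E S)" for S by (auto simp: E_def finite_tuples)
  have cP: "real (card (Pow {1..n})) = 2 ^ n" by (simp add: card_Pow)
  \<comment> \<open>The average number of down-directions is at least \<open>\<epsilon> * n\<close>,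
    so convexity applies to the tuples of down-directions.\<close>
  have "\<epsilon> * n * card (Pow {1..n}) \<le> (\<Sum>X\<in>Pow {1..n}. real (card (down_directions H X)))"
    using dens unfolding cP card_edges_eq_sum_down_directions[OF H] by simp
  then have "card (Pow {1..n}) * (\<epsilon> * n) ^ k
      \<le> (\<Sum>X\<in>Pow {1..n}. real (card (down_directions H X)) ^ k)"
    using assms(2) by (intro sum_power_ge_of_average) auto
  also have "\<dots> = (\<Sum>X\<in>Pow {1..n}. real (card (tuples k (down_directions H X))))"
    by (intro sum.cong) (auto simp: card_tuples fin_dd)
  also have "\<dots> = real (card ?T)"
    by (subst card_SigmaI) (auto simp: finite_tuples fin_dd)
  also have "card ?T \<le> card (SIGMA S:Pow {1..n}. E S)"
  proof (rule card_inj_on_le)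
    show "inj_on (\<lambda>(X, xs). (X - set xs, xs)) ?T"
      by (rule inj_onI) (auto simp: tuples_def down_directions_def)
    show "(\<lambda>(X, xs). (X - set xs, xs)) ` ?T \<subseteq> (SIGMA S:Pow {1..n}. E S)"
    proof clarify
      fix X xs assume X: "X \<subseteq> {1..n}" and xs: "xs \<in> tuples k (down_directions H X)"
      then have "X - set xs \<union> set xs = X" "set xs \<subseteq> {1..n}"
        by (auto simp: tuples_def down_directions_def)
      then show "X - set xs \<in> Pow {1..n} \<and> xs \<in> E (X - set xs)"
        using X xs by (auto simp: E_def tuples_def)
    qed
  qed (auto simp: finE)
  also have "card (SIGMA S:Pow {1..n}. E S) = (\<Sum>S\<in>Pow {1..n}. card (E S))"
    by (intro card_SigmaI) (auto simp: finE)
  finally have sum_ge: "2 ^ n * (\<epsilon> * n) ^ k \<le> (\<Sum>S\<in>Pow {1..n}. real (card (E S)))"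
    unfolding cP by simp
  \<comment> \<open>There are as many bases as vertices, so averaging over bases keeps the full
    bound.\<close>
  have "\<exists>S\<in>Pow {1..n}. (\<epsilon> * n) ^ k \<le> card (E S)"
  proof (rule ccontr)
    assume "\<not> ?thesis"
    then have "(\<Sum>S\<in>Pow {1..n}. real (card (E S))) < (\<Sum>S\<in>Pow {1..n}. (\<epsilon> * n) ^ k)"
      by (intro sum_strict_mono) (auto simp: not_le)
    then show False using sum_ge by (simp add: card_Pow)
  qed
  then show thesis using that by (auto simp: E_def power_mult_distrib)
qed

section \<open>Transferring a partite representation into a dense subgraph\<close>

lemma isomorphic_trans:
  assumes "isomorphic G G'" "isomorphic G' G''"
  shows "isomorphic G G''"
proof -
  obtain f g where f: "bij_betw f (verts G) (verts G')" "edges G' = (\<lambda>e. f ` e) ` edges G"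
    and g: "bij_betw g (verts G') (verts G'')" "edges G'' = (\<lambda>e. g ` e) ` edges G'"
    using assms by (auto simp: isomorphic_def)
  have "bij_betw (g \<circ> f) (verts G) (verts G'')" using f g by (blast intro: bij_betw_trans)
  moreover have "edges G'' = (\<lambda>e. (g \<circ> f) ` e) ` edges G"
    by (simp add: f g image_image image_comp)
  ultimately show ?thesis unfolding isomorphic_def by blast
qed

text \<open>As \<open>\<phi>\<close> is injective and avoids \<open>S\<close>, symmetric differences
  keep their size, so adjacency is both preserved and reflected; reflection gives inducedness.
  \<open>vH\<close> is separate from \<open>eH\<close> because \<open>G'\<close> may have isolated
  vertices.\<close>

lemma subcube_embedding_copy:
  assumes ind: "induced_subgraph G' (hypercube m)"
    and S: "S \<subseteq> {1..n}" and \<phi>: "inj_on \<phi> {1..m}" "\<phi> ` {1..m} \<subseteq> {1..n} - S"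
    and vH: "\<And>X. X \<in> verts G' \<Longrightarrow> S \<union> \<phi> ` X \<in> verts H"
    and eH: "\<And>X Y. {X, Y} \<in> edges G' \<Longrightarrow> {S \<union> \<phi> ` X, S \<union> \<phi> ` Y} \<in> edges H"
    and iso: "isomorphic G G'"
  shows "contains_copy_induced_in (hypercube n) H G"
proof -
  define f where "f X = S \<union> \<phi> ` X" for X
  define G'' where "G'' = (f ` verts G', (\<lambda>e. f ` e) ` edges G')"
  have sg: "simple_graph G'" and vG: "verts G' \<subseteq> Pow {1..m}"
    and eG: "edges G' = {e \<in> edges (hypercube m). e \<subseteq> verts G'}"
    using ind by (auto simp: induced_subgraph_def subgraph_def hypercube_def)
  have sym: "card (sym_diff (f X) (f Y)) = card (sym_diff X Y)"
    if "X \<subseteq> {1..m}" "Y \<subseteq> {1..m}" for X Y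
  proof -
    have "sym_diff (f X) (f Y) = sym_diff (\<phi> ` X) (\<phi> ` Y)"
      using \<phi>(2) that by (auto simp: f_def)
    also have "\<dots> = \<phi> ` sym_diff X Y"
      using that by (simp add: image_Un inj_on_image_set_diff[OF \<phi>(1)] Diff_subset le_supI1
          subset_trans[OF Diff_subset])
    finally show ?thesis
      using card_image[OF inj_on_subset[OF \<phi>(1), of "sym_diff X Y"]] that by auto
  qed
  have injf: "inj_on f (Pow {1..m})"
  proof (rule inj_onI)
    fix X Y assume XY: "X \<in> Pow {1..m}" "Y \<in> Pow {1..m}" "f X = f Y"
    then have "\<phi> ` X = \<phi> ` Y" using \<phi>(2) by (auto simp: f_def) blast+
    then show "X = Y" using XY \<phi>(1) by (simp add: inj_on_image_eq_iff)
  qed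
  have injv: "inj_on f (verts G')" using injf vG by (rule inj_on_subset)
  have f_sub: "f X \<subseteq> {1..n}" if "X \<subseteq> {1..m}" for X
    using that S \<phi>(2) by (auto simp: f_def)
  have edge_iff: "{f X, f Y} \<in> edges (hypercube n) \<longleftrightarrow> {X, Y} \<in> edges (hypercube m)"
    if "X \<subseteq> {1..m}" "Y \<subseteq> {1..m}" for X Y
  proof -
    have "{X, Y} \<in> edges (hypercube l) \<longleftrightarrow> card (sym_diff X Y) = 1"
      if "X \<subseteq> {1..l}" "Y \<subseteq> {1..l}" for X Y l
      using that by (auto simp: hypercube_def doubleton_eq_iff Un_commute)
    then show ?thesis using that f_sub sym by simp
  qed
  have pair: "\<exists>X Y. e = {X, Y} \<and> X \<in> verts G' \<and> Y \<in> verts G'" if "e \<in> edges G'" for e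
    using that sg by (fastforce simp: simple_graph_def card_2_iff)
  have sg'': "simple_graph G''"
    unfolding simple_graph_def
  proof (intro conjI ballI)
    show "finite (verts G'')" using sg by (simp add: G''_def simple_graph_def)
    fix e assume "e \<in> edges G''"
    then obtain e' where e': "e' \<in> edges G'" "e = f ` e'" by (auto simp: G''_def)
    then have "e' \<subseteq> verts G'" "card e' = 2" using sg by (auto simp: simple_graph_def)
    then show "e \<subseteq> verts G''" "card e = 2"
      using e' injv by (auto simp: G''_def card_image inj_on_subset)
  qed
  have eH'': "edges G'' \<subseteq> edges H"
  proof
    fix e assume "e \<in> edges G''"
    then obtain e' where "e' \<in> edges G'" "e = f ` e'" by (auto simp: G''_def)
    then show "e \<in> edges H" using pair[of e'] eH by (auto simp: f_def)
  qed
  have "subgraph G'' H"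
    using sg'' eH'' vH by (auto simp: subgraph_def G''_def f_def)
  moreover have "edges G'' = {e \<in> edges (hypercube n). e \<subseteq> verts G''}"
  proof (intro equalityI subsetI)
    fix e assume e: "e \<in> edges G''"
    then obtain e' where e': "e' \<in> edges G'" "e = f ` e'" by (auto simp: G''_def)
    obtain X Y where XY: "e' = {X, Y}" "X \<in> verts G'" "Y \<in> verts G'" using pair e' by blast
    then have "{f X, f Y} \<in> edges (hypercube n)"
      using edge_iff[of X Y] e' eG vG by auto
    then show "e \<in> {e \<in> edges (hypercube n). e \<subseteq> verts G''}"
      using XY e' by (simp add: G''_def)
  next
    fix e assume "e \<in> {e \<in> edges (hypercube n). e \<subseteq> verts G''}"
    then have e: "e \<in> edges (hypercube n)" "e \<subseteq> f ` verts G'" by (auto simp: G''_def)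
    from e(1) obtain U V where UV: "e = {U, V}" by (auto simp: hypercube_def)
    then have "U \<in> f ` verts G'" "V \<in> f ` verts G'" using e(2) by blast+
    then obtain X Y where XY: "X \<in> verts G'" "Y \<in> verts G'" "e = {f X, f Y}" using UV by blast
    then have "{X, Y} \<in> edges G'" using edge_iff[of X Y] e(1) eG vG by auto
    then have "f ` {X, Y} \<in> edges G''" unfolding G''_def snd_conv by (rule imageI)
    then show "e \<in> edges G''" using XY by simp
  qed
  moreover have "verts G'' \<subseteq> verts (hypercube n)"
    unfolding G''_def hypercube_def fst_conv using vG f_sub by blast
  ultimately have "induced_subgraph G'' (hypercube n)" "subgraph G'' H"
    using sg'' unfolding induced_subgraph_def subgraph_def by blast+
  moreover have "isomorphic G' G''"
    using injv by (auto simp: isomorphic_def G''_def bij_betw_def)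
  ultimately show ?thesis
    using iso isomorphic_trans unfolding contains_copy_induced_in_def by blast
qed

text \<open>A cube edge removes one element from its larger end, and for \<open>k > 0\<close> the
  cardinalities force that end to be \<open>X\<close>.\<close>

lemma down_nbrs_subset:
  assumes "X \<subseteq> {1..n}" "card X = k" "k > 0"
  shows "down_nbrs n k X \<subseteq> {X - {x} | x. x \<in> X}"
proof
  fix Y assume "Y \<in> down_nbrs n k X"
  then have Y: "Y \<subseteq> {1..n}" "card Y = k - 1" and edge: "{X, Y} \<in> edges (hypercube n)"
    by (auto simp: down_nbrs_def vertex_layer_def hypercube_def)
  from edge obtain Z z where Z: "z \<in> Z" "{X, Y} = {Z, Z - {z}}" by (rule hypercube_edgeE)
  have "\<not> X \<subseteq> Y"
  proof
    assume "X \<subseteq> Y"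
    then have "card X \<le> card Y" using Y by (intro card_mono) (auto intro: finite_subset)
    then show False using assms Y by simp
  qed
  then have "X = Z" "Y = Z - {z}" using Z by (auto simp: doubleton_eq_iff)
  then show "Y \<in> {X - {x} | x. x \<in> X}" using Z by blast
qed

text \<open>Disjointness of the parts makes the glued map well defined; disjointness of the blocks
  makes it injective across parts.\<close>

lemma inj_glue_disjoint_blocks:
  assumes P: "disjoint_family_on P {..<k}" and B: "disjoint_family_on B {..<k}"
    and fin: "\<And>i. i < k \<Longrightarrow> finite (P i) \<and> finite (B i) \<and> card (P i) \<le> card (B i)"
  obtains \<phi> where "inj_on \<phi> (\<Union>i<k. P i)" "\<And>i. i < k \<Longrightarrow> \<phi> ` P i \<subseteq> B i"
proof -
  have "\<forall>i\<in>{..<k}. \<exists>f. f ` P i \<subseteq> B i \<and> inj_on f (P i)"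
    using fin card_le_inj by blast
  then obtain f where f: "\<And>i. i < k \<Longrightarrow> f i ` P i \<subseteq> B i \<and> inj_on (f i) (P i)"
    by (metis lessThan_iff)
  define idx where "idx p = (THE i. i < k \<and> p \<in> P i)" for p
  have idx: "idx p = i" if "i < k" "p \<in> P i" for i p
    unfolding idx_def using that P by (intro the_equality) (auto simp: disjoint_family_on_def)
  define \<phi> where "\<phi> p = f (idx p) p" for p
  have img: "\<phi> ` P i \<subseteq> B i" if "i < k" for i
    using that f idx by (force simp: \<phi>_def)
  moreover have "inj_on \<phi> (\<Union>i<k. P i)"
  proof (rule inj_onI)
    fix p q assume "p \<in> (\<Union>i<k. P i)" "q \<in> (\<Union>i<k. P i)" and eq: "\<phi> p = \<phi> q"
    then obtain i j where ij: "i < k" "p \<in> P i" "j < k" "q \<in> P j" by auto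
    then have "\<phi> p \<in> B i" "\<phi> q \<in> B j" using img by blast+
    then have "i = j" using B ij eq by (auto simp: disjoint_family_on_def)
    then show "p = q" using ij eq f idx by (auto simp: \<phi>_def inj_on_def)
  qed
  ultimately show thesis using that by blast
qed

text \<open>Partiteness is what lets \<open>\<phi>\<close> send every set of \<open>A\<close> to a
  transversal of the blocks. The condition \<open>edges H \<noteq> {}\<close> supplies a vertex of
  \<open>H\<close> when \<open>k = 0\<close>; for \<open>n = 0\<close> the density bound would
  not.\<close>

lemma dense_subgraph_contains_copy:
  fixes \<epsilon> :: real
  assumes rep: "has_induced_partite_representation k G" and "\<epsilon> > 0"
  obtains N where "\<And>n H. \<lbrakk>N \<le> n; subgraph H (hypercube n); edges H \<noteq> {};
      \<epsilon> * n * 2 ^ n \<le> card (edges H)\<rbrakk> \<Longrightarrow> contains_copy_induced_in (hypercube n) H G"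
proof -
  obtain m A G' where A: "A \<subseteq> vertex_layer m k"
    and partite: "k_partite k (layer_hypergraph m A)"
    and sub: "subgraph G' (down_stars_union m k A)"
    and ind: "induced_subgraph G' (hypercube m)" and iso: "isomorphic G G'"
    using rep unfolding has_induced_partite_representation_def by blast
  from partite obtain P where disjP: "disjoint_family_on P {..<k}"
    and UP: "(\<Union>i<k. P i) = {1..m}"
    and one: "\<And>a i. a \<in> A \<Longrightarrow> i < k \<Longrightarrow> card (a \<inter> P i) = 1"
    unfolding k_partite_def layer_hypergraph_def by auto
  show thesis
  proof (cases "k = 0")
    \<comment> \<open>Without parts the ground set \<open>{1..m}\<close> is empty, so
      \<open>G'\<close> has at most one vertex and no edge, and any vertex of \<open>H\<close> can
      host it.\<close>
    case True
    then have m: "m = 0" using UP by simp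
    have vG: "verts G' \<subseteq> {{}}" and sg: "simple_graph G'"
      using ind m by (auto simp: induced_subgraph_def subgraph_def hypercube_def)
    have eG: "edges G' = {}"
    proof (rule ccontr)
      assume "edges G' \<noteq> {}"
      then obtain e where "e \<in> edges G'" by blast
      then have "e \<subseteq> verts G'" "card e = 2" using sg by (simp_all add: simple_graph_def)
      then have "e \<subseteq> {{}}" "card e = 2" using vG by (simp_all add: subset_trans)
      then show False using card_mono[of "{{}}" e] by simp
    qed
    show thesis
    proof (rule that[of 0])
      fix n H assume H: "subgraph H (hypercube n)" "edges H \<noteq> {}"
      then obtain e where "e \<in> edges H" by blast
      then have "e \<subseteq> verts H" "card e = 2"
        using H by (simp_all add: subgraph_def simple_graph_def)
      then obtain S where S: "S \<in> verts H" by fastforce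
      then have "S \<subseteq> {1..n}" using H by (auto simp: subgraph_def hypercube_def)
      then show "contains_copy_induced_in (hypercube n) H G"
        using ind iso S vG eG
        by (intro subcube_embedding_copy[of G' m S n id H G]) (auto simp: m)
    qed
  next
    case False
    then have k: "k > 0" by simp
    have finP: "finite (P i)" "card (P i) \<le> m" if "i < k" for i
    proof -
      have "P i \<subseteq> {1..m}" using UP that by blast
      then show "finite (P i)" "card (P i) \<le> m"
        using card_mono[of "{1..m}" "P i"] by (auto intro: finite_subset)
    qed
    \<comment> \<open>Every part has at most \<open>m\<close> elements, so blocks of size
      \<open>m\<close> could receive them; \<open>Suc m\<close> also makes the blocks nonempty when
      \<open>m = 0\<close>.\<close>
    have "\<epsilon> ^ k > 0" using assms by simp
    from dense_tuples_contain_blocks[OF this, of 0 k "Suc m"] obtain N where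
      N: "\<forall>(V :: nat set) W E. finite V \<and> N \<le> card V \<and> finite W \<and> card W \<le> 0 \<and>
        E \<subseteq> tuples k V \<and> \<epsilon> ^ k * real (card V) ^ k \<le> card E \<longrightarrow>
        (\<exists>B. (\<forall>i<k. B i \<subseteq> V - W \<and> card (B i) = Suc m) \<and> disjoint_family_on B {..<k} \<and>
          (\<forall>xs. length xs = k \<and> (\<forall>i<k. xs ! i \<in> B i) \<longrightarrow> xs \<in> E))"
      by (rule exE)
    show thesis
    proof (rule that[of N])
      fix n H
      assume n: "N \<le> n" and H: "subgraph H (hypercube n)"
        and dens: "\<epsilon> * n * 2 ^ n \<le> card (edges H)"
      have eH: "edges H \<subseteq> edges (hypercube n)" and sgH: "simple_graph H"
        using H by (auto simp: subgraph_def)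
      define E where "E S = {xs \<in> tuples k ({1..n} - S). set xs \<subseteq> down_directions H (S \<union> set xs)}"
        for S
      obtain S where S: "S \<subseteq> {1..n}" and ES: "\<epsilon> ^ k * real n ^ k \<le> card (E S)"
        using dense_subgraph_has_dense_base[OF eH _ dens, of k] assms(2) unfolding E_def by auto
      \<comment> \<open>The blocks are sought in all of \<open>{1..n}\<close>, because the density
        of \<open>E S\<close> is measured against \<open>n ^ k\<close>; that they avoid
        \<open>S\<close> is recovered afterwards.\<close>
      have "\<exists>B. (\<forall>i<k. B i \<subseteq> {1..n} - {} \<and> card (B i) = Suc m) \<and> disjoint_family_on B {..<k} \<and>
          (\<forall>xs. length xs = k \<and> (\<forall>i<k. xs ! i \<in> B i) \<longrightarrow> xs \<in> E S)"
        using n ES by (intro N[rule_format]) (auto simp: E_def tuples_def)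
      then obtain B where B: "\<And>i. i < k \<Longrightarrow> B i \<subseteq> {1..n} \<and> card (B i) = Suc m"
        and disjB: "disjoint_family_on B {..<k}"
        and BE: "\<And>xs. length xs = k \<Longrightarrow> (\<And>i. i < k \<Longrightarrow> xs ! i \<in> B i) \<Longrightarrow> xs \<in> E S"
        by (metis Diff_empty)
      \<comment> \<open>Any \<open>b\<close> in a block extends, by representatives of the other
        blocks, to a tuple of \<open>E S\<close>, whose entries lie outside
        \<open>S\<close>.\<close>
      have BS: "B i \<inter> S = {}" if "i < k" for i
      proof -
        have "b \<notin> S" if b: "b \<in> B i" for b
        proof -
          have "B j \<noteq> {}" if "j < k" for j using B[OF that] by auto
          then have "\<forall>j. \<exists>c. j < k \<longrightarrow> c \<in> B j" by blast
          then obtain c where c: "\<And>j. j < k \<Longrightarrow> c j \<in> B j" by metis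
          have "map (c(i := b)) [0..<k] \<in> E S" using c b by (intro BE) auto
          moreover have "b \<in> set (map (c(i := b)) [0..<k])" using \<open>i < k\<close> by auto
          ultimately show ?thesis unfolding E_def tuples_def by blast
        qed
        then show ?thesis by blast
      qed
      have "finite (P i) \<and> finite (B i) \<and> card (P i) \<le> card (B i)" if "i < k" for i
        using finP[OF that] B[OF that] by (auto intro: finite_subset)
      from inj_glue_disjoint_blocks[OF disjP disjB this] obtain \<phi> where
        inj: "inj_on \<phi> {1..m}" and \<phi>: "\<And>i. i < k \<Longrightarrow> \<phi> ` P i \<subseteq> B i"
        unfolding UP by blast
      have img: "\<phi> ` {1..m} \<subseteq> {1..n} - S"
        unfolding UP[symmetric] using \<phi> B BS by fastforce
      \<comment> \<open>The set \<open>a\<close> has one point \<open>c i\<close> in each part, so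
        the tuple of the \<open>\<phi> (c i)\<close> lies in \<open>E S\<close>. Hence every element
        of \<open>\<phi>\<close> a\<open>is a down-direction at\<close>S \<union> \<phi>
        \<open>a\<close>.\<close>
      have star: "{S \<union> \<phi> ` a, S \<union> \<phi> ` (a - {p})} \<in> edges H" if a: "a \<in> A" and p: "p \<in> a" for a p
      proof -
        have am: "a \<subseteq> {1..m}" using A a by (auto simp: vertex_layer_def hypercube_def)
        have "\<forall>i\<in>{..<k}. \<exists>c. a \<inter> P i = {c}"
          using one[OF a] by (auto simp: card_1_singleton_iff)
        then obtain c where c: "\<And>i. i < k \<Longrightarrow> a \<inter> P i = {c i}" by (metis lessThan_iff)
        have a_eq: "a = c ` {..<k}"
        proof -
          have "a = (\<Union>i<k. a \<inter> P i)" using am UP by auto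
          also have "\<dots> = c ` {..<k}" using c by auto
          finally show ?thesis .
        qed
        have "map (\<phi> \<circ> c) [0..<k] \<in> E S"
          using c \<phi> by (intro BE) (auto simp: image_subset_iff)
        moreover have "set (map (\<phi> \<circ> c) [0..<k]) = \<phi> ` a"
          by (simp add: a_eq image_image lessThan_atLeast0)
        ultimately have "\<phi> ` a \<subseteq> down_directions H (S \<union> \<phi> ` a)"
          unfolding E_def by auto
        then have "{S \<union> \<phi> ` a, (S \<union> \<phi> ` a) - {\<phi> p}} \<in> edges H"
          using p by (auto simp: down_directions_def)
        moreover have "(S \<union> \<phi> ` a) - {\<phi> p} = S \<union> \<phi> ` (a - {p})"
        proof -
          have "\<phi> p \<notin> S" using img am p by blast
          moreover have "a - {p} \<subseteq> {1..m}" "{p} \<subseteq> {1..m}" using am p by blast+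
          then have "\<phi> ` (a - {p}) = \<phi> ` a - {\<phi> p}"
            using inj_on_image_set_diff[OF inj, of a "{p}"] by simp
          ultimately show ?thesis by auto
        qed
        ultimately show ?thesis by simp
      qed
      \<comment> \<open>As \<open>k > 0\<close>, every centre has an edge in its star, so vertices
        of \<open>G'\<close> land in \<open>verts H\<close> as ends of edges of
        \<open>H\<close>.\<close>
      have nbrs: "down_nbrs m k a \<subseteq> {a - {p} | p. p \<in> a}" and ne: "a \<noteq> {}" if "a \<in> A" for a
        using A that k down_nbrs_subset[of a m k] by (auto simp: vertex_layer_def hypercube_def)
      have inH: "U \<in> verts H \<and> V \<in> verts H" if "{U, V} \<in> edges H" for U V
        using that sgH by (auto simp: simple_graph_def)
      show "contains_copy_induced_in (hypercube n) H G"
      proof (rule subcube_embedding_copy[OF ind S inj img _ _ iso])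
        fix X assume "X \<in> verts G'"
        then obtain a where a: "a \<in> A" "X = a \<or> X \<in> down_nbrs m k a"
          using sub by (auto simp: subgraph_def down_stars_union_def down_star_def)
        then obtain p where "p \<in> a" "X = a \<or> X = a - {p}"
          using nbrs[OF a(1)] ne[OF a(1)] by blast
        then show "S \<union> \<phi> ` X \<in> verts H" using inH[OF star[OF a(1)]] by blast
      next
        fix X Y assume "{X, Y} \<in> edges G'"
        then obtain a Z where a: "a \<in> A" "Z \<in> down_nbrs m k a" "{X, Y} = {a, Z}"
          using sub unfolding subgraph_def down_stars_union_def down_star_def by auto
        obtain p where p: "p \<in> a" "Z = a - {p}" using nbrs[OF a(1)] a(2) by blast
        \<comment> \<open>Mapping the whole doubleton avoids deciding which of \<open>X\<close> and
          \<open>Y\<close> is the centre.\<close>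
        have "{S \<union> \<phi> ` X, S \<union> \<phi> ` Y} = (\<lambda>U. S \<union> \<phi> ` U) ` {X, Y}" by simp
        also have "\<dots> = {S \<union> \<phi> ` a, S \<union> \<phi> ` (a - {p})}"
          by (simp only: a(3) p(2) image_insert image_empty)
        finally show "{S \<union> \<phi> ` X, S \<union> \<phi> ` Y} \<in> edges H"
          using star[OF a(1) p(1)] by simp
      qed
    qed
  qed
qed

section \<open>From dense subgraphs to the extremal numbers\<close>

text \<open>Passing from \<open>Q\<close> to \<open>H\<close> only removes edges and keeps those of
  \<open>G'\<close>. Thus one density bound serves both extremal numbers.\<close>

lemma contains_induced_copy_if_cube_induced:
  assumes "subgraph H Q" "contains_copy_induced_in Q H G"
  shows "contains_induced_copy H G"
proof -
  obtain G' where G': "subgraph G' H" "induced_subgraph G' Q" "isomorphic G G'"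
    using assms(2) by (auto simp: contains_copy_induced_in_def)
  have "edges G' \<subseteq> edges H" "edges H \<subseteq> edges Q"
    and "edges G' = {e \<in> edges Q. e \<subseteq> verts G'}"
    using G' assms(1) by (simp_all add: subgraph_def induced_subgraph_def)
  then have "edges G' = {e \<in> edges H. e \<subseteq> verts G'}" by blast
  then show ?thesis
    using G' unfolding contains_induced_copy_def induced_subgraph_def by blast
qed

text \<open>The supremum of the empty set of naturals is 0, which \<open>0 \<le> c\<close>
  covers.\<close>

lemma real_Sup_nat_le:
  fixes c :: real
  assumes "\<And>x. x \<in> X \<Longrightarrow> real x \<le> c" "0 \<le> c"
  shows "real (Sup X) \<le> c"
proof (cases "X = {}")
  case True
  then show ?thesis using assms by (simp add: Sup_nat_def)
next
  case False
  then have "Sup X \<le> nat \<lfloor>c\<rfloor>" using assms by (intro cSup_least) (auto simp: le_nat_floor)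
  then show ?thesis using assms(2) by linarith
qed

theorem theoremA1:
  fixes G :: "'a ugraph" and k :: nat
  assumes "simple_graph G"
    and "has_induced_partite_representation k G"
  shows "(\<lambda>n. real (ex_induced n G)) \<in> o(\<lambda>n. real (card (edges (hypercube n)))) \<and>
         (\<lambda>n. real (ex_cube_induced n G)) \<in> o(\<lambda>n. real (card (edges (hypercube n))))"
proof -
  have "eventually (\<lambda>n. real (ex_induced n G) \<le> c * card (edges (hypercube n)) \<and>
      real (ex_cube_induced n G) \<le> c * card (edges (hypercube n))) at_top" if "c > 0" for c :: real
  proof -
    \<comment> \<open>Since \<open>n * 2 ^ n\<close> is twice the number of edges of the cube,
      density \<open>c\<close> corresponds to \<open>\<epsilon> = c / 2\<close>.\<close>
    have "c / 2 > 0" using that by simp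
    from dense_subgraph_contains_copy[OF assms(2) this] obtain N where
      N: "\<And>n H. \<lbrakk>N \<le> n; subgraph H (hypercube n); edges H \<noteq> {};
        c / 2 * n * 2 ^ n \<le> card (edges H)\<rbrakk> \<Longrightarrow> contains_copy_induced_in (hypercube n) H G"
      by blast
    \<comment> \<open>The strict inequality also ensures that \<open>H\<close> has an edge; its
      contrapositive bounds every member of the two sets of edge counts.\<close>
    have copy: "contains_copy_induced_in (hypercube n) H G"
      if "N \<le> n" "subgraph H (hypercube n)" "c * card (edges (hypercube n)) < card (edges H)" for n H
    proof (rule N[OF that(1,2)])
      have "real n * 2 ^ n = 2 * real (card (edges (hypercube n)))"
        using card_edges_hypercube[of n] by (metis of_nat_mult of_nat_numeral of_nat_power)
      then have "c / 2 * n * 2 ^ n = c * card (edges (hypercube n))" by (simp add: mult.assoc)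
      then show "c / 2 * n * 2 ^ n \<le> card (edges H)" using that(3) by linarith
      have "0 \<le> c * card (edges (hypercube n))" using \<open>c > 0\<close> by simp
      then show "edges H \<noteq> {}" using that(3) by auto
    qed
    show ?thesis
    proof (rule eventually_at_top_linorderI[of N], intro conjI)
      fix n assume n: "N \<le> n"
      show "real (ex_cube_induced n G) \<le> c * card (edges (hypercube n))"
        unfolding ex_cube_induced_def
      proof (rule real_Sup_nat_le, clarify)
        fix H assume "subgraph H (hypercube n)" "\<not> contains_copy_induced_in (hypercube n) H G"
        then show "real (card (edges H)) \<le> c * card (edges (hypercube n))"
          using copy[OF n, of H] by force
      qed (use \<open>c > 0\<close> in simp)
      show "real (ex_induced n G) \<le> c * card (edges (hypercube n))"
        unfolding ex_induced_def
      proof (rule real_Sup_nat_le, clarify)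
        fix H assume "subgraph H (hypercube n)" "\<not> contains_induced_copy H G"
        then show "real (card (edges H)) \<le> c * card (edges (hypercube n))"
          using copy[OF n, of H] contains_induced_copy_if_cube_induced[of H "hypercube n" G] by force
      qed (use \<open>c > 0\<close> in simp)
    qed
  qed
  then show ?thesis
    by (intro conjI landau_o.smallI) (simp_all add: eventually_conj_iff)
qed

end
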